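(* Consider the two-stage stochastic lot-sizing problem SLSCC (defined in the context) and suppose that the stronger Wagner–Whitin condition holds: $\alpha_i+h_i\ge\alpha_{i+1}$ for $i=1,\dots,p$, and $\alpha_i+(1-\varepsilon)h_i\ge\alpha_{i+1}$ for $i=p+1,\dots,T-1$. Then there exists an optimal solution $(x,y,s,(s_{ji}),z)$ of SLSCC whose production and inventory levels have the following form, with $\psi,J_z$ defined from this solution: (a) if $x_i>0$, then $$x_i=\begin{cases}\sum_{t=i}^{\psi(i)-1}d_t, & \psi(i)\le p,\\ \sum_{t=i}^{p}d_t+\max_{\tau\in J_z}\Big\{\sum_{t=p+1}^{\psi(i)-1}d_{\tau t}\Big\}, & i\le p,\ \psi(i)\ge p+1,\\ \max_{\tau\in J_z}\Big\{\sum_{t=p+1}^{\psi(i)-1}d_{\tau t}\Big\}-\max_{\tau\in J_z}\Big\{\sum_{t=p+1}^{i-1}d_{\tau t}\Big\}, & i\ge p+1;\end{cases}$$ (b) for the first-stage inventory levels, $$s_i=\begin{cases}\sum_{t=i+1}^{\psi(i)-1}d_t, & \psi(i)\le p,\\ \sum_{t=i+1}^{p}d_t+\max_{\tau\in J_z}\Big\{\sum_{t=p+1}^{\psi(i)-1}d_{\tau t}\Big\}, & i\le p,\ \psi(i)\ge p+1;\end{cases}$$ (c) if $z_j=0$, then $$s_{ji}=\max_{\tau\in J_z}\Big\{\sum_{t=p+1}^{\psi(i)-1}d_{\tau t}\Big\}-\sum_{t=p+1}^{i}d_{jt},\qquad i\in[p+1,T];$$ (d) if $z_j=1$, then $s_{ji}=0$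 for $i\in[p+1,T]$.
   Context: For integers $a\le b$, $[a,b]=\{a,a+1,\dots,b\}$; empty sums are $0$. Problem SLSCC. Data: horizon length $T$, $N=\{1,\dots,T\}$, a period $p\in N$ (first stage: periods $1,\dots,p$, with deterministic demands; second stage: periods $p+1,\dots,T$, with random demands); a finite scenario set $\Omega=\{1,\dots,m\}$, where scenario $j$ has probability $p_j$; a given risk threshold $\varepsilon$; first-stage demands $d_i$ ($i\in[1,p]$); second-stage demands $d_{ji}$ in period $i\in[p+1,T]$ under scenario $j\in\Omega$; unit production costs $\alpha_i$, setup costs $\beta_i$, unit holding costs $h_i$ ($i\in N$), the second-stage holding costs $h_i$, $i\in[p+1,T]$, being nonnegative. Constants: $M_i=\sum_{t=i}^{p}d_t+\max_{j\in\Omega}\sum_{t=p+1}^{T}d_{jt}$ for $i\in[1,p]$ and $M_i=\max_{j\in\Omega}\sum_{t=i}^{T}d_{jt}$ for $i\in[p+1,T]$. SLSCC is the problem $$\min\ \sum_{i=1}^{p}(\alpha_ix_i+\beta_iy_i+h_is_i)+\sum_{i=p+1}^{T}(\alpha_ix_i+\beta_iy_i)+\sum_{j=1}^{m}p_j\sum_{i=p+1}^{T}h_is_{ji}$$ subject to - $x_i+s_{i-1}=d_i+s_i$, $i\in[1,p]$ (with $s_0=0$); - $s_p+\sum_{i=p+1}^{t}x_i\ge\sum_{i=p+1}^{t}d_{ji}(1-z_j)$, $t\in[p+1,T]$, $j\in\Omega$; - $\sum_{j=1}^{m}p_jz_j\le\varepsilon$; - $s_{ji}\ge\big[\sum_{t=p+1}^{i}(x_t-d_{jt})+s_p\big](1-z_j)$,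 $i\in[p+1,T]$, $j\in\Omega$; - $x_i\le M_iy_i$, $i\in N$; - $x_i\ge0$ ($i\in N$), $s_i\ge0$ ($i\in[1,p]$), $s_{ji}\ge0$ ($i\in[p+1,T]$, $j\in\Omega$), $y_i\in\{0,1\}$ ($i\in N$), $z_j\in\{0,1\}$ ($j\in\Omega$). Conventions: $y_{T+1}=1$ and $\alpha_{T+1}=0$. Given $y$ and $z$: $\psi(i)$ is the earliest period after $i$ that is set up, i.e. $\psi(i)=\min\{k\ge i+1:y_k=1\}$ (so $\psi(i)=T+1$ if no period in $[i+1,T]$ is set up); $J_z=\{j\in\Omega:z_j=0\}$.
   Formalization: Adds, for p<T, the Wagner–Whitin inequality at i=T, α_T+(1-ε)h_T ≥ 0 = α_{T+1}, without which the claim fails (overproduction can pay); demands are taken nonnegative, 0≤ε≤1, and a maximum over an empty J_z (only if ε=1) is read as 0. *)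

theory Defs
  imports Complex_Main
begin

record slscc =
  horizon :: nat                        \<comment> \<open>\<open>T\<close>\<close>
  stage :: nat                          \<comment> \<open>\<open>p\<close>, the last first-stage period\<close>
  scen_count :: nat                     \<comment> \<open>\<open>m\<close>\<close>
  scen_prob :: "nat \<Rightarrow> real"            \<comment> \<open>\<open>p\<^sub>j\<close>\<close>
  risk :: real                          \<comment> \<open>\<open>\<epsilon>\<close>\<close>
  dem :: "nat \<Rightarrow> real"                  \<comment> \<open>\<open>d\<^sub>i\<close>, first stage\<close>
  scen_dem :: "nat \<Rightarrow> nat \<Rightarrow> real"      \<comment> \<open>\<open>d\<^sub>j\<^sub>i\<close>, scenario first, then period\<close>
  prod_cost :: "nat \<Rightarrow> real"            \<comment> \<open>\<open>\<alpha>\<^sub>i\<close>\<close>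
  setup_cost :: "nat \<Rightarrow> real"           \<comment> \<open>\<open>\<beta>\<^sub>i\<close>\<close>
  hold_cost :: "nat \<Rightarrow> real"            \<comment> \<open>\<open>h\<^sub>i\<close>\<close>

record plan =
  lot :: "nat \<Rightarrow> real"                  \<comment> \<open>\<open>x\<^sub>i\<close>\<close>
  setup_var :: "nat \<Rightarrow> real"            \<comment> \<open>\<open>y\<^sub>i\<close>\<close>
  stock :: "nat \<Rightarrow> real"                \<comment> \<open>\<open>s\<^sub>i\<close>, first stage\<close>
  scen_stock :: "nat \<Rightarrow> nat \<Rightarrow> real"    \<comment> \<open>\<open>s\<^sub>j\<^sub>i\<close>, scenario first, then period\<close>
  viol :: "nat \<Rightarrow> real"                 \<comment> \<open>\<open>z\<^sub>j\<close>\<close>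

abbreviation scens :: "slscc \<Rightarrow> nat set" where
  "scens P \<equiv> {1..scen_count P}"

text \<open>The entry \<open>T + 1\<close> of \<open>prod_cost\<close> is padding that carries the convention \<open>\<alpha>\<^sub>T\<^sub>+\<^sub>1 = 0\<close>. No sign is
  imposed on production costs, setup costs or first-stage holding costs.\<close>

definition slscc_data :: "slscc \<Rightarrow> bool" where
  "slscc_data P \<longleftrightarrow>
     1 \<le> stage P \<and> stage P \<le> horizon P \<and>
     (\<forall>j\<in>scens P. 0 \<le> scen_prob P j) \<and> (\<Sum>j\<in>scens P. scen_prob P j) = 1 \<and>
     0 \<le> risk P \<and> risk P \<le> 1 \<and>
     (\<forall>i\<in>{1..stage P}. 0 \<le> dem P i) \<and>
     (\<forall>j\<in>scens P. \<forall>i\<in>{stage P + 1..horizon P}. 0 \<le> scen_dem P j i) \<and>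
     (\<forall>i\<in>{stage P + 1..horizon P}. 0 \<le> hold_cost P i) \<and>
     prod_cost P (horizon P + 1) = 0"

definition big_M :: "slscc \<Rightarrow> nat \<Rightarrow> real" where
  "big_M P i =
     (if i \<le> stage P
      then (\<Sum>t=i..stage P. dem P t)
           + Max ((\<lambda>j. \<Sum>t=stage P + 1..horizon P. scen_dem P j t) ` scens P)
      else Max ((\<lambda>j. \<Sum>t=i..horizon P. scen_dem P j t) ` scens P))"

text \<open>Two constraints encode conventions on padding entries: \<open>s\<^sub>0 = 0\<close> and \<open>y\<^sub>T\<^sub>+\<^sub>1 = 1\<close>. The latter
  entry enters neither the other constraints nor the objective.\<close>

definition feasible :: "slscc \<Rightarrow> plan \<Rightarrow> bool" where
  "feasible P S \<longleftrightarrow>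
     stock S 0 = 0 \<and> setup_var S (horizon P + 1) = 1 \<and>
     (\<forall>i\<in>{1..stage P}. lot S i + stock S (i - 1) = dem P i + stock S i) \<and>
     (\<forall>t\<in>{stage P + 1..horizon P}. \<forall>j\<in>scens P.
        stock S (stage P) + (\<Sum>i=stage P + 1..t. lot S i)
          \<ge> (\<Sum>i=stage P + 1..t. scen_dem P j i * (1 - viol S j))) \<and>
     (\<Sum>j\<in>scens P. scen_prob P j * viol S j) \<le> risk P \<and>
     (\<forall>i\<in>{stage P + 1..horizon P}. \<forall>j\<in>scens P.
        scen_stock S j i
          \<ge> ((\<Sum>t=stage P + 1..i. lot S t - scen_dem P j t) + stock S (stage P)) * (1 - viol S j)) \<and>
     (\<forall>i\<in>{1..horizon P}. lot S i \<le> big_M P i * setup_var S i) \<and>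
     (\<forall>i\<in>{1..horizon P}. 0 \<le> lot S i) \<and>
     (\<forall>i\<in>{1..stage P}. 0 \<le> stock S i) \<and>
     (\<forall>i\<in>{stage P + 1..horizon P}. \<forall>j\<in>scens P. 0 \<le> scen_stock S j i) \<and>
     (\<forall>i\<in>{1..horizon P}. setup_var S i \<in> {0, 1}) \<and>
     (\<forall>j\<in>scens P. viol S j \<in> {0, 1})"

definition total_cost :: "slscc \<Rightarrow> plan \<Rightarrow> real" where
  "total_cost P S =
     (\<Sum>i=1..stage P. prod_cost P i * lot S i + setup_cost P i * setup_var S i
                      + hold_cost P i * stock S i)
     + (\<Sum>i=stage P + 1..horizon P. prod_cost P i * lot S i + setup_cost P i * setup_var S i)
     + (\<Sum>j\<in>scens P. scen_prob P j * (\<Sum>i=stage P + 1..horizon P. hold_cost P i * scen_stock S j i))"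

definition optimal :: "slscc \<Rightarrow> plan \<Rightarrow> bool" where
  "optimal P S \<longleftrightarrow> feasible P S \<and> (\<forall>S'. feasible P S' \<longrightarrow> total_cost P S \<le> total_cost P S')"

definition strong_wagner_whitin :: "slscc \<Rightarrow> bool" where
  "strong_wagner_whitin P \<longleftrightarrow>
     (\<forall>i\<in>{1..stage P}. prod_cost P i + hold_cost P i \<ge> prod_cost P (i + 1)) \<and>
     (\<forall>i\<in>{stage P + 1..horizon P - 1}.
        prod_cost P i + (1 - risk P) * hold_cost P i \<ge> prod_cost P (i + 1))"

definition next_setup :: "plan \<Rightarrow> nat \<Rightarrow> nat" where
  "next_setup S i = (LEAST k. k \<ge> i + 1 \<and> setup_var S k = 1)"

definition kept :: "slscc \<Rightarrow> plan \<Rightarrow> nat set" where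
  "kept P S = {j \<in> scens P. viol S j = 0}"

text \<open>The quantity \<open>max\<^bsub>\<tau>\<in>J\<^sub>z\<^esub> \<Sum>\<^bsub>t=p+1..k\<^esub> d\<^bsub>\<tau>t\<^esub>\<close>. For \<open>\<epsilon> < 1\<close> a feasible plan always has \<open>J\<^sub>z\<close>
  nonempty; the value 0 for empty \<open>J\<^sub>z\<close> is a convention that matters only when \<open>\<epsilon> = 1\<close>.\<close>

definition max_dem :: "slscc \<Rightarrow> plan \<Rightarrow> nat \<Rightarrow> real" where
  "max_dem P S k =
     (if kept P S = {} then 0
      else Max ((\<lambda>\<tau>. \<Sum>t=stage P + 1..k. scen_dem P \<tau> t) ` kept P S))"

end

theory Submission
  imports Defs
begin

text \<open>
  Everything is phrased in the cumulative production \<open>X\<^sub>i = x\<^sub>1 + \<dots> + x\<^sub>i\<close>. Once the binary decisions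
  \<open>y\<close> and \<open>z\<close> are given, the demand constraints say that \<open>X\<close> dominates the nondecreasing function
  \<open>required\<close>: the cumulative demand during the first stage, and from then on that demand plus the
  largest second-stage demand among the scenarios of \<open>J\<^sub>z\<close>. Moreover \<open>X\<close> is constant between
  consecutive setups, so \<open>X\<^sub>i = X\<^bsub>\<psi>(i)-1\<^esub>\<close>, and \<open>X\<^sub>i\<close> is at least the requirement at \<open>\<psi>(i) - 1\<close>.

  Taking equality in this bound for all \<open>i\<close> gives the pointwise least \<open>X\<close> that \<open>y\<close> and \<open>z\<close>
  admit. The plan built from it, called lean here, is again feasible (\<open>lean_feasible\<close>), and the
  formulas of the theorem just spell out its lots and stocks.

  The Wagner-Whitin condition implies that decreasing \<open>X\<close> never costs anything. After summation by parts,
  the unit production costs charge \<open>\<alpha>\<^sub>i - \<alpha>\<^bsub>i+1\<^esub>\<close> per unit of \<open>X\<^sub>i\<close>. Holding adds \<open>h\<^sub>i\<close> in the first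
  stage and \<open>h\<^sub>i\<close> times the probability of \<open>J\<^sub>z\<close> in the second. The chance constraint makes that
  probability at least \<open>1 - \<epsilon>\<close>, and as \<open>h\<^sub>i\<close> is nonnegative there, every coefficient is nonnegative
  (\<open>less_production_is_cheaper\<close>). Hence a lean plan is cheapest among the feasible plans that share
  its \<open>y\<close> and \<open>z\<close> (\<open>lean_best_for_decisions\<close>).

  There are only finitely many choices of \<open>y\<close> and \<open>z\<close>, and at least one is feasible, so a cheapest
  lean plan exists, and it is optimal.
\<close>

section \<open>Cumulative demand\<close>

definition cum_dem :: "slscc \<Rightarrow> nat \<Rightarrow> real" where
  "cum_dem P k = (\<Sum>t=1..k. dem P t)"

definition cum_scen_dem :: "slscc \<Rightarrow> nat \<Rightarrow> nat \<Rightarrow> real" where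
  "cum_scen_dem P j k = (\<Sum>t=stage P + 1..k. scen_dem P j t)"

text \<open>The least cumulative production through period \<open>k\<close> that serves the first-stage demand and every
  kept scenario.\<close>

definition required :: "slscc \<Rightarrow> plan \<Rightarrow> nat \<Rightarrow> real" where
  "required P S k =
     (if k \<le> stage P then cum_dem P k else cum_dem P (stage P) + max_dem P S k)"

lemma sum_split_at:
  fixes f :: "nat \<Rightarrow> 'a::comm_monoid_add"
  assumes "m \<le> k + 1" "k \<le> n"
  shows "(\<Sum>t=m..n. f t) = (\<Sum>t=m..k. f t) + (\<Sum>t=k+1..n. f t)"
  using sum.ub_add_nat[of m k f "n - k"] assms by simp

lemma finite_kept: "finite (kept P S)"
  by (simp add: kept_def)

lemma max_dem_attained:
  assumes "kept P S \<noteq> {}"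
  obtains j where "j \<in> kept P S" "max_dem P S k = cum_scen_dem P j k"
proof -
  have "max_dem P S k \<in> (\<lambda>j. cum_scen_dem P j k) ` kept P S"
    using assms Max_in[of "(\<lambda>j. cum_scen_dem P j k) ` kept P S"]
    by (simp add: max_dem_def cum_scen_dem_def finite_kept)
  then show thesis using that by blast
qed

lemma cum_scen_dem_le_max_dem:
  assumes "j \<in> kept P S"
  shows "cum_scen_dem P j k \<le> max_dem P S k"
proof -
  have "cum_scen_dem P j k \<le> Max ((\<lambda>j. cum_scen_dem P j k) ` kept P S)"
    by (rule Max_ge) (use assms in \<open>auto simp: finite_kept\<close>)
  moreover have "kept P S \<noteq> {}" using assms by auto
  ultimately show ?thesis by (simp add: max_dem_def cum_scen_dem_def)
qed

lemma max_dem_empty: "kept P S = {} \<Longrightarrow> max_dem P S k = 0"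
  by (simp add: max_dem_def)

lemma max_dem_stage [simp]: "max_dem P S (stage P) = 0"
proof (cases "kept P S = {}")
  case False
  then obtain j where "max_dem P S (stage P) = cum_scen_dem P j (stage P)"
    by (rule max_dem_attained)
  then show ?thesis by (simp add: cum_scen_dem_def)
qed (simp add: max_dem_empty)

text \<open>The two branches of \<open>required\<close> agree at the boundary period, so the second may start there.\<close>

lemma required_after_stage:
  "stage P \<le> k \<Longrightarrow> required P S k = cum_dem P (stage P) + max_dem P S k"
  by (cases "k = stage P") (auto simp: required_def)

lemma cum_dem_diff:
  assumes "i \<le> k"
  shows "cum_dem P k - cum_dem P i = (\<Sum>t=i+1..k. dem P t)"
  using sum_split_at[of 1 i k "dem P"] assms by (simp add: cum_dem_def)

lemma cum_scen_dem_diff: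
  assumes "stage P \<le> i" "i \<le> k"
  shows "cum_scen_dem P j k - cum_scen_dem P j i = (\<Sum>t=i+1..k. scen_dem P j t)"
  using sum_split_at[of "stage P + 1" i k "scen_dem P j"] assms by (simp add: cum_scen_dem_def)

lemma cum_dem_mono:
  assumes "slscc_data P" "i \<le> k" "k \<le> stage P"
  shows "cum_dem P i \<le> cum_dem P k"
proof -
  have "0 \<le> (\<Sum>t=i+1..k. dem P t)"
    by (rule sum_nonneg) (use assms in \<open>auto simp: slscc_data_def\<close>)
  then show ?thesis using cum_dem_diff[OF assms(2), of P] by linarith
qed

lemma cum_scen_dem_mono:
  assumes "slscc_data P" "j \<in> scens P" "stage P \<le> i" "i \<le> k" "k \<le> horizon P"
  shows "cum_scen_dem P j i \<le> cum_scen_dem P j k"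
proof -
  have "0 \<le> (\<Sum>t=i+1..k. scen_dem P j t)"
    by (rule sum_nonneg) (use assms in \<open>auto simp: slscc_data_def\<close>)
  then show ?thesis using cum_scen_dem_diff[OF assms(3,4), of j] by linarith
qed

lemma max_dem_mono:
  assumes "slscc_data P" "stage P \<le> i" "i \<le> k" "k \<le> horizon P"
  shows "max_dem P S i \<le> max_dem P S k"
proof (cases "kept P S = {}")
  case False
  then obtain j where j: "j \<in> kept P S" "max_dem P S i = cum_scen_dem P j i"
    by (rule max_dem_attained)
  moreover have "cum_scen_dem P j i \<le> cum_scen_dem P j k"
    using j assms by (intro cum_scen_dem_mono) (auto simp: kept_def)
  ultimately show ?thesis using cum_scen_dem_le_max_dem[of j P S k] by linarith
qed (simp add: max_dem_empty)

lemma required_0 [simp]: "required P S 0 = 0"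
  by (simp add: required_def cum_dem_def)

lemma required_mono:
  assumes "slscc_data P" "i \<le> k" "k \<le> horizon P"
  shows "required P S i \<le> required P S k"
proof (cases "k \<le> stage P")
  case True
  then show ?thesis using assms cum_dem_mono by (simp add: required_def)
next
  case k: False
  show ?thesis
  proof (cases "stage P \<le> i")
    case True
    then show ?thesis using assms max_dem_mono[of P i k S] by (simp add: required_after_stage)
  next
    case False
    have "cum_dem P i \<le> cum_dem P (stage P)"
      using False assms by (intro cum_dem_mono) auto
    moreover have "0 \<le> max_dem P S k"
      using max_dem_mono[of P "stage P" k S] k assms by simp
    ultimately show ?thesis using k False by (simp add: required_def)
  qed
qed

text \<open>The big-M bound never cuts off a lot that covers exactly the demand of periods \<open>i\<close> to \<open>k\<close>. In
  the second stage, the scenario attaining the maximum at \<open>k\<close> bounds the difference of maxima by its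
  own demand from \<open>i\<close> onwards.\<close>

lemma required_diff_le_big_M:
  assumes P: "slscc_data P" and i: "1 \<le> i" "i \<le> k" and k: "k \<le> horizon P"
  shows "required P S k - required P S (i - 1) \<le> big_M P i"
proof -
  have ne: "scens P \<noteq> {}"
  proof
    assume "scens P = {}"
    then have "(\<Sum>j\<in>scens P. scen_prob P j) = 0" by (simp only: sum.empty)
    then show False using P by (simp add: slscc_data_def)
  qed
  have stage: "1 \<le> stage P" "stage P \<le> horizon P" using P by (auto simp: slscc_data_def)
  have max_dem_diff: "max_dem P S b - max_dem P S (a - 1)
      \<le> Max ((\<lambda>j. \<Sum>t=a..horizon P. scen_dem P j t) ` scens P)"
    if ab: "stage P + 1 \<le> a" "a \<le> b + 1" "b \<le> horizon P" for a b
  proof -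
    have below_Max: "(\<Sum>t=a..horizon P. scen_dem P j t)
        \<le> Max ((\<lambda>j. \<Sum>t=a..horizon P. scen_dem P j t) ` scens P)" if "j \<in> scens P" for j
      by (rule Max_ge) (use that in auto)
    have tail: "cum_scen_dem P j b - cum_scen_dem P j (a - 1)
        \<le> (\<Sum>t=a..horizon P. scen_dem P j t)" if "j \<in> scens P" for j
    proof -
      have "cum_scen_dem P j b \<le> cum_scen_dem P j (horizon P)"
        using ab that by (intro cum_scen_dem_mono[OF P]) auto
      moreover have "stage P \<le> a - 1" "a - 1 \<le> horizon P" "a - 1 + 1 = a" using ab by auto
      ultimately show ?thesis using cum_scen_dem_diff[of P "a - 1" "horizon P" j] by simp
    qed
    show ?thesis
    proof (cases "kept P S = {}")
      case True
      obtain j where j: "j \<in> scens P" using ne by blast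
      have "0 \<le> (\<Sum>t=a..horizon P. scen_dem P j t)"
        by (rule sum_nonneg) (use ab j P in \<open>auto simp: slscc_data_def\<close>)
      then show ?thesis using below_Max[OF j] True by (simp add: max_dem_empty)
    next
      case False
      then obtain j where j: "j \<in> kept P S" "max_dem P S b = cum_scen_dem P j b"
        by (rule max_dem_attained)
      have "j \<in> scens P" using j by (simp add: kept_def)
      then show ?thesis
        using below_Max[of j] tail[of j] j cum_scen_dem_le_max_dem[of j P S "a - 1"] by linarith
    qed
  qed
  show ?thesis
  proof (cases "i \<le> stage P")
    case i_first: True
    have first: "cum_dem P (stage P) - cum_dem P (i - 1) = (\<Sum>t=i..stage P. dem P t)"
      using cum_dem_diff[of "i - 1" "stage P" P] i i_first by simp
    \<comment> \<open>Raising \<open>k\<close> to the end of the first stage only enlarges the left side and leaves one case.\<close>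
    have "required P S k \<le> required P S (max k (stage P))"
      using k stage P by (intro required_mono) auto
    also have "\<dots> = cum_dem P (stage P) + max_dem P S (max k (stage P))"
      by (simp add: required_after_stage)
    finally show ?thesis
      using max_dem_diff[of "stage P + 1" "max k (stage P)"] k stage i_first i first
      by (simp add: big_M_def required_def)
  next
    case False
    then show ?thesis
      using max_dem_diff[of i k] i k by (simp add: big_M_def required_after_stage)
  qed
qed

section \<open>Setup periods\<close>

text \<open>A setup in some period \<open>n + 1\<close> beyond \<open>i\<close> makes the least element in \<open>next_setup\<close> exist. It is
  used with \<open>n = T\<close>, where the convention \<open>y\<^bsub>T+1\<^esub> = 1\<close> provides that setup.\<close>

lemma next_setup_props:
  assumes "setup_var S (n + 1) = 1" "i \<le> n"
  shows "i + 1 \<le> next_setup S i" "next_setup S i \<le> n + 1"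
    and "setup_var S (next_setup S i) = 1"
    and "\<And>k. i + 1 \<le> k \<Longrightarrow> k < next_setup S i \<Longrightarrow> setup_var S k \<noteq> 1"
proof -
  have ex: "i + 1 \<le> n + 1 \<and> setup_var S (n + 1) = 1" using assms by simp
  show "i + 1 \<le> next_setup S i" "setup_var S (next_setup S i) = 1"
    using LeastI[of "\<lambda>k. k \<ge> i + 1 \<and> setup_var S k = 1", OF ex] by (auto simp: next_setup_def)
  show "next_setup S i \<le> n + 1"
    using Least_le[of "\<lambda>k. k \<ge> i + 1 \<and> setup_var S k = 1", OF ex] by (simp add: next_setup_def)
  show "setup_var S k \<noteq> 1" if "i + 1 \<le> k" "k < next_setup S i" for k
    using not_less_Least[of k "\<lambda>k. k \<ge> i + 1 \<and> setup_var S k = 1"] that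
    by (auto simp: next_setup_def)
qed

lemma next_setup_eqI:
  assumes "i + 1 \<le> k" "setup_var S k = 1" "\<And>l. i + 1 \<le> l \<Longrightarrow> l < k \<Longrightarrow> setup_var S l \<noteq> 1"
  shows "next_setup S i = k"
  unfolding next_setup_def
  by (rule Least_equality) (use assms not_le in blast)+

lemma next_setup_pred:
  assumes "setup_var S (n + 1) = 1" "1 \<le> i" "i \<le> n"
  shows "next_setup S (i - 1) = (if setup_var S i = 1 then i else next_setup S i)"
proof (cases "setup_var S i = 1")
  case True
  then show ?thesis using assms by (simp add: next_setup_eqI)
next
  case False
  note props = next_setup_props[OF assms(1,3)]
  have "next_setup S (i - 1) = next_setup S i"
  proof (rule next_setup_eqI)
    fix l assume "i - 1 + 1 \<le> l" "l < next_setup S i"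
    then show "setup_var S l \<noteq> 1" using False props(4)[of l] assms by (cases "l = i") auto
  qed (use props assms in auto)
  then show ?thesis using False by simp
qed

section \<open>Feasible plans in terms of cumulative production\<close>

definition cum_lot :: "plan \<Rightarrow> nat \<Rightarrow> real" where
  "cum_lot S k = (\<Sum>t=1..k. lot S t)"

lemma cum_lot_diff:
  assumes "i \<le> k"
  shows "cum_lot S k - cum_lot S i = (\<Sum>t=i+1..k. lot S t)"
  using sum_split_at[of 1 i k "lot S"] assms by (simp add: cum_lot_def)

lemma stock_eq:
  assumes "feasible P S" "i \<le> stage P"
  shows "stock S i = cum_lot S i - cum_dem P i"
  using assms(2)
proof (induction i)
  case 0
  then show ?case using assms(1) by (simp add: feasible_def cum_lot_def cum_dem_def)
next
  case (Suc i)
  have "\<forall>k\<in>{1..stage P}. lot S k + stock S (k - 1) = dem P k + stock S k"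
    using assms(1) unfolding feasible_def by blast
  moreover have "Suc i \<in> {1..stage P}" using Suc.prems by simp
  ultimately have "lot S (Suc i) + stock S (Suc i - 1) = dem P (Suc i) + stock S (Suc i)"
    by (rule bspec)
  then show ?case using Suc by (simp add: cum_lot_def cum_dem_def)
qed

lemma available_eq:
  assumes "feasible P S" "stage P \<le> i"
  shows "stock S (stage P) + (\<Sum>t=stage P + 1..i. lot S t) = cum_lot S i - cum_dem P (stage P)"
  using stock_eq[OF assms(1), of "stage P"] cum_lot_diff[OF assms(2), of S] by simp

lemma feasible_scen_stock_ge:
  assumes "feasible P S" "i \<in> {stage P + 1..horizon P}" "j \<in> scens P"
  shows "(cum_lot S i - cum_dem P (stage P) - cum_scen_dem P j i) * (1 - viol S j)
    \<le> scen_stock S j i"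
proof -
  have "((\<Sum>t=stage P + 1..i. lot S t - scen_dem P j t) + stock S (stage P)) * (1 - viol S j)
      \<le> scen_stock S j i"
    using assms by (simp add: feasible_def)
  moreover have "(\<Sum>t=stage P + 1..i. lot S t - scen_dem P j t) + stock S (stage P)
      = cum_lot S i - cum_dem P (stage P) - cum_scen_dem P j i"
    using available_eq[OF assms(1), of i] assms(2)
    by (simp add: sum_subtractf cum_scen_dem_def)
  ultimately show ?thesis by simp
qed

lemma cum_lot_mono:
  assumes "feasible P S" "i \<le> k" "k \<le> horizon P"
  shows "cum_lot S i \<le> cum_lot S k"
proof -
  have "0 \<le> (\<Sum>t=i+1..k. lot S t)"
    by (rule sum_nonneg) (use assms in \<open>auto simp: feasible_def\<close>)
  then show ?thesis using cum_lot_diff[OF assms(2), of S] by linarith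
qed

text \<open>In the second stage the demand constraint of a scenario attaining the maximum gives the bound.
  If no scenario is kept, the maximum is 0 and nonnegativity of the stock handed over suffices.\<close>

lemma required_le_cum_lot:
  assumes P: "slscc_data P" and S: "feasible P S" and k: "k \<le> horizon P"
  shows "required P S k \<le> cum_lot S k"
proof -
  have stock_nonneg: "0 \<le> stock S i" if "i \<le> stage P" for i
    using S that by (cases "i = 0") (auto simp: feasible_def)
  show ?thesis
  proof (cases "k \<le> stage P")
    case True
    then show ?thesis using stock_nonneg[of k] stock_eq[OF S True] by (simp add: required_def)
  next
    case late: False
    show ?thesis
    proof (cases "kept P S = {}")
      case True
      have "cum_dem P (stage P) \<le> cum_lot S (stage P)"
        using stock_nonneg[of "stage P"] stock_eq[OF S, of "stage P"] by simp
      also have "\<dots> \<le> cum_lot S k" using late k by (intro cum_lot_mono[OF S]) auto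
      finally show ?thesis using late True by (simp add: required_def max_dem_empty)
    next
      case False
      then obtain j where j: "j \<in> kept P S" "max_dem P S k = cum_scen_dem P j k"
        by (rule max_dem_attained)
      then have "viol S j = 0" "j \<in> scens P" by (auto simp: kept_def)
      moreover have "k \<in> {stage P + 1..horizon P}" using late k by simp
      moreover have "\<forall>t\<in>{stage P + 1..horizon P}. \<forall>j\<in>scens P.
          (\<Sum>i=stage P + 1..t. scen_dem P j i * (1 - viol S j))
          \<le> stock S (stage P) + (\<Sum>i=stage P + 1..t. lot S i)"
        using S unfolding feasible_def by blast
      ultimately have "(\<Sum>i=stage P + 1..k. scen_dem P j i * (1 - viol S j))
          \<le> stock S (stage P) + (\<Sum>t=stage P + 1..k. lot S t)" by blast
      then have "cum_scen_dem P j k \<le> stock S (stage P) + (\<Sum>t=stage P + 1..k. lot S t)"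
        using \<open>viol S j = 0\<close> by (simp add: cum_scen_dem_def)
      then show ?thesis using available_eq[OF S, of k] late j by (simp add: required_def)
    qed
  qed
qed

text \<open>Without a setup, \<open>x\<^sub>i \<le> M\<^sub>i y\<^sub>i\<close> forces \<open>x\<^sub>i = 0\<close>, so \<open>X\<close> is constant up to the next setup.\<close>

lemma cum_lot_next_setup:
  assumes S: "feasible P S" and i: "i \<le> horizon P"
  shows "cum_lot S (next_setup S i - 1) = cum_lot S i"
proof -
  have y: "setup_var S (horizon P + 1) = 1" using S by (simp add: feasible_def)
  note props = next_setup_props[OF y i]
  have "lot S t = 0" if t: "t \<in> {i+1..next_setup S i - 1}" for t
  proof -
    have t': "t \<in> {1..horizon P}" "t < next_setup S i" using t props by auto
    have "setup_var S t \<noteq> 1" using props(4)[of t] t t' by auto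
    then have "setup_var S t = 0" using S t' by (auto simp: feasible_def)
    moreover have "lot S t \<le> big_M P t * setup_var S t" "0 \<le> lot S t"
      using S t' by (auto simp: feasible_def)
    ultimately show ?thesis by simp
  qed
  then have "(\<Sum>t=i+1..next_setup S i - 1. lot S t) = 0" by simp
  then show ?thesis using cum_lot_diff[of i "next_setup S i - 1" S] props by simp
qed

section \<open>Plans built from cumulative production\<close>

text \<open>Keeping the binary decisions of \<open>S\<close>, a cumulative production determines the lots by
  differences and the first-stage stock by balance. The scenario stocks are set to the least values
  that the holding constraints allow.\<close>

definition plan_of_cum :: "slscc \<Rightarrow> plan \<Rightarrow> (nat \<Rightarrow> real) \<Rightarrow> plan" where
  "plan_of_cum P S X = S\<lparr>
     lot := \<lambda>i. X i - X (i - 1),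
     stock := \<lambda>i. X i - cum_dem P i,
     scen_stock := \<lambda>j i. if viol S j = 0
       then X i - cum_dem P (stage P) - cum_scen_dem P j i else 0\<rparr>"

lemma cum_lot_plan_of_cum:
  assumes "X 0 = 0"
  shows "cum_lot (plan_of_cum P S X) i = X i"
  by (induction i) (simp_all add: cum_lot_def plan_of_cum_def assms)

lemma plan_of_cum_feasible:
  assumes P: "slscc_data P"
    and y: "setup_var S (horizon P + 1) = 1" "\<And>i. i \<in> {1..horizon P} \<Longrightarrow> setup_var S i \<in> {0, 1}"
    and z: "\<And>j. j \<in> scens P \<Longrightarrow> viol S j \<in> {0, 1}"
    and risk: "(\<Sum>j\<in>scens P. scen_prob P j * viol S j) \<le> risk P"
    and X0: "X 0 = 0"
    and X_covers: "\<And>i. i \<le> horizon P \<Longrightarrow> required P S i \<le> X i"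
    and X_step: "\<And>i. i \<in> {1..horizon P} \<Longrightarrow> X (i - 1) \<le> X i"
      "\<And>i. i \<in> {1..horizon P} \<Longrightarrow> X i - X (i - 1) \<le> big_M P i * setup_var S i"
  shows "feasible P (plan_of_cum P S X)"
proof -
  let ?L = "plan_of_cum P S X"
  have stage: "1 \<le> stage P" "stage P \<le> horizon P" using P by (auto simp: slscc_data_def)
  have [simp]: "lot ?L i = X i - X (i - 1)" "stock ?L i = X i - cum_dem P i"
    "setup_var ?L = setup_var S" "viol ?L = viol S" for i
    by (simp_all add: plan_of_cum_def)
  have balance: "lot ?L i + stock ?L (i - 1) = dem P i + stock ?L i"
    if "i \<in> {1..stage P}" for i
    using that cum_dem_diff[of "i - 1" i P] by simp
  have sum_lot: "(\<Sum>t=stage P + 1..i. lot ?L t) = X i - X (stage P)" if "stage P \<le> i" for i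
    using cum_lot_diff[OF that, of ?L] by (simp add: cum_lot_plan_of_cum[of X, OF X0])
  have covers: "cum_scen_dem P j t \<le> X t - cum_dem P (stage P)"
    if "t \<in> {stage P + 1..horizon P}" "j \<in> scens P" "viol S j = 0" for t j
    using X_covers[of t] cum_scen_dem_le_max_dem[of j P S t] that
    by (auto simp: kept_def required_def)
  have nonneg: "0 \<le> X t - cum_dem P (stage P)" if "t \<in> {stage P + 1..horizon P}" for t
    using X_covers[of t] required_mono[OF P, of "stage P" t S] that
    by (simp add: required_after_stage)
  have demand: "(\<Sum>i=stage P + 1..t. scen_dem P j i * (1 - viol ?L j))
      \<le> stock ?L (stage P) + (\<Sum>i=stage P + 1..t. lot ?L i)"
    if "t \<in> {stage P + 1..horizon P}" "j \<in> scens P" for t j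
    using z[OF that(2)] covers[OF that] nonneg[OF that(1)] sum_lot[of t] that
    by (auto simp: cum_scen_dem_def)
  have holding: "((\<Sum>t=stage P + 1..i. lot ?L t - scen_dem P j t) + stock ?L (stage P))
        * (1 - viol ?L j) \<le> scen_stock ?L j i"
    if "i \<in> {stage P + 1..horizon P}" "j \<in> scens P" for i j
  proof -
    have "(\<Sum>t=stage P + 1..i. lot ?L t - scen_dem P j t) + stock ?L (stage P)
        = X i - cum_dem P (stage P) - cum_scen_dem P j i"
      using sum_lot[of i] that by (simp add: sum_subtractf cum_scen_dem_def)
    then show ?thesis using z[OF that(2)] by (auto simp: plan_of_cum_def)
  qed
  have scen_nonneg: "0 \<le> scen_stock ?L j i"
    if "i \<in> {stage P + 1..horizon P}" "j \<in> scens P" for i j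
    using covers[OF that] by (auto simp: plan_of_cum_def)
  have stock_nonneg: "0 \<le> stock ?L i" if "i \<in> {1..stage P}" for i
    using X_covers[of i] that stage by (simp add: required_def)
  have "stock ?L 0 = 0" by (simp add: X0 cum_dem_def)
  then show ?thesis
    using y z risk balance demand holding X_step stock_nonneg scen_nonneg
    unfolding feasible_def by simp
qed

text \<open>With a setup in every period and no scenario given up, producing the requirement period by
  period is feasible.\<close>

lemma feasible_exists:
  assumes P: "slscc_data P"
  shows "\<exists>S. feasible P S"
proof -
  define S where "S = \<lparr>lot = \<lambda>_. 0, setup_var = \<lambda>_. 1, stock = \<lambda>_. 0,
    scen_stock = \<lambda>_ _. 0, viol = \<lambda>_. 0\<rparr>"
  have "feasible P (plan_of_cum P S (required P S))"
  proof (rule plan_of_cum_feasible[OF P])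
    fix i assume "i \<in> {1..horizon P}"
    then show "required P S (i - 1) \<le> required P S i"
      and "required P S i - required P S (i - 1) \<le> big_M P i * setup_var S i"
      using required_mono[OF P, of "i - 1" i S] required_diff_le_big_M[OF P, of i i S]
      by (auto simp: S_def)
  qed (use P in \<open>auto simp: S_def slscc_data_def\<close>)
  then show ?thesis ..
qed

section \<open>Lean plans\<close>

definition lean_cum :: "slscc \<Rightarrow> plan \<Rightarrow> nat \<Rightarrow> real" where
  "lean_cum P S i = required P S (next_setup S i - 1)"

definition lean :: "slscc \<Rightarrow> plan \<Rightarrow> plan" where
  "lean P S = plan_of_cum P S (lean_cum P S)"

lemma lean_setup_var [simp]: "setup_var (lean P S) = setup_var S"
  and lean_viol [simp]: "viol (lean P S) = viol S"
  by (simp_all add: lean_def plan_of_cum_def)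

lemma lean_next_setup [simp]: "next_setup (lean P S) = next_setup S"
  and lean_kept [simp]: "kept P (lean P S) = kept P S"
  by (simp_all add: next_setup_def kept_def fun_eq_iff)

lemma lean_max_dem [simp]: "max_dem P (lean P S) = max_dem P S"
  by (simp add: max_dem_def fun_eq_iff)

text \<open>The lower bound that all feasible plans obey and the lean plan attains: the requirement at
  \<open>\<psi>(i) - 1\<close> has to be met from production through period \<open>i\<close>.\<close>

lemma lean_cum_le:
  assumes P: "slscc_data P" and S: "feasible P S" and i: "i \<le> horizon P"
  shows "lean_cum P S i \<le> cum_lot S i"
proof -
  have y: "setup_var S (horizon P + 1) = 1" using S by (simp add: feasible_def)
  have "required P S (next_setup S i - 1) \<le> cum_lot S (next_setup S i - 1)"
    using next_setup_props(2)[OF y i] by (intro required_le_cum_lot[OF P S]) auto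
  then show ?thesis using cum_lot_next_setup[OF S i] by (simp add: lean_cum_def)
qed

lemma required_le_lean_cum:
  assumes P: "slscc_data P" and S: "feasible P S" and i: "i \<le> horizon P"
  shows "required P S i \<le> lean_cum P S i"
proof -
  have y: "setup_var S (horizon P + 1) = 1" using S by (simp add: feasible_def)
  show ?thesis unfolding lean_cum_def
    using next_setup_props(1,2)[OF y i] by (intro required_mono[OF P]) auto
qed

text \<open>Demand before the first setup cannot be met, so feasibility of \<open>S\<close> makes it vanish. This is
  what lets \<open>lean_cum\<close> start at 0.\<close>

lemma lean_cum_0:
  assumes P: "slscc_data P" and S: "feasible P S"
  shows "lean_cum P S 0 = 0"
  using lean_cum_le[OF P S, of 0] required_le_lean_cum[OF P S, of 0] by (simp add: cum_lot_def)

lemma cum_lot_lean: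
  assumes P: "slscc_data P" and S: "feasible P S"
  shows "cum_lot (lean P S) i = lean_cum P S i"
  unfolding lean_def using lean_cum_0[OF P S] by (rule cum_lot_plan_of_cum)

text \<open>If \<open>i\<close> is set up, then \<open>\<psi>(i - 1) = i\<close>; otherwise \<open>\<psi>(i - 1) = \<psi>(i)\<close>, so that
  nothing is produced.\<close>

lemma lean_cum_step:
  assumes S: "feasible P S" and i: "1 \<le> i" "i \<le> horizon P"
  shows "lean_cum P S i - lean_cum P S (i - 1) =
    (if setup_var S i = 1 then required P S (next_setup S i - 1) - required P S (i - 1) else 0)"
proof -
  have "setup_var S (horizon P + 1) = 1" using S by (simp add: feasible_def)
  from next_setup_pred[OF this i] show ?thesis by (auto simp: lean_cum_def)
qed

lemma lean_feasible:
  assumes P: "slscc_data P" and S: "feasible P S"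
  shows "feasible P (lean P S)"
  unfolding lean_def
proof (rule plan_of_cum_feasible[OF P])
  show y: "setup_var S (horizon P + 1) = 1" using S by (simp add: feasible_def)
  show "(\<Sum>j\<in>scens P. scen_prob P j * viol S j) \<le> risk P" using S by (simp add: feasible_def)
  show "lean_cum P S 0 = 0" using P S by (rule lean_cum_0)
  show "required P S i \<le> lean_cum P S i" if "i \<le> horizon P" for i
    using P S that by (rule required_le_lean_cum)
  show "viol S j \<in> {0, 1}" if "j \<in> scens P" for j using S that by (auto simp: feasible_def)
  fix i assume i: "i \<in> {1..horizon P}"
  then have i': "1 \<le> i" "i \<le> horizon P" by auto
  show y_binary: "setup_var S i \<in> {0, 1}" using S i by (auto simp: feasible_def)
  have next_i: "i \<le> next_setup S i - 1" "next_setup S i - 1 \<le> horizon P"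
    using next_setup_props(1,2)[OF y i'(2)] by auto
  show "lean_cum P S (i - 1) \<le> lean_cum P S i"
  proof -
    have "i - 1 \<le> next_setup S i - 1" using next_i(1) by linarith
    from required_mono[OF P this next_i(2), of S] show ?thesis
      using lean_cum_step[OF S i'] by (simp split: if_splits)
  qed
  show "lean_cum P S i - lean_cum P S (i - 1) \<le> big_M P i * setup_var S i"
    using required_diff_le_big_M[OF P i'(1) next_i, of S] y_binary lean_cum_step[OF S i'] by auto
qed

section \<open>Costs\<close>

lemma sum_by_parts:
  fixes a c :: "nat \<Rightarrow> real"
  assumes "c 0 = 0"
  shows "(\<Sum>i=1..n. a i * (c i - c (i - 1)))
    = (\<Sum>i=1..n. (a i - a (i + 1)) * c i) + a (n + 1) * c n"
  by (induction n) (simp_all add: assms algebra_simps)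

text \<open>The cost difference of the two plans is at least a combination of the differences \<open>c\<^sub>i = X'\<^sub>i - X\<^sub>i\<close> with
  coefficients \<open>\<alpha>\<^sub>i - \<alpha>\<^bsub>i+1\<^esub> + h\<^sub>i\<close> in the first stage and
  \<open>\<alpha>\<^sub>i - \<alpha>\<^bsub>i+1\<^esub> + w h\<^sub>i\<close> in the second, where \<open>w\<close> is the probability of the kept scenarios. It is not
  equal to this combination in general, because the scenario stocks of \<open>S'\<close> may exceed their lower
  bounds whereas those of \<open>S\<close> are tight. The hypothesis on the last period is the Wagner-Whitin
  inequality at \<open>i = T\<close> with \<open>\<alpha>\<^bsub>T+1\<^esub> = 0\<close>.\<close>

lemma less_production_is_cheaper:
  assumes P: "slscc_data P" and WW: "strong_wagner_whitin P"
    and last: "stage P < horizon P \<Longrightarrow>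
           0 \<le> prod_cost P (horizon P) + (1 - risk P) * hold_cost P (horizon P)"
    and S: "feasible P S" and S': "feasible P S'"
    and setups: "\<And>i. i \<in> {1..horizon P} \<Longrightarrow> setup_var S i = setup_var S' i"
    and viols: "\<And>j. j \<in> scens P \<Longrightarrow> viol S j = viol S' j"
    and tight: "\<And>i j. i \<in> {stage P + 1..horizon P} \<Longrightarrow> j \<in> scens P \<Longrightarrow> scen_stock S j i
      = (cum_lot S i - cum_dem P (stage P) - cum_scen_dem P j i) * (1 - viol S j)"
    and less: "\<And>i. i \<le> horizon P \<Longrightarrow> cum_lot S i \<le> cum_lot S' i"
  shows "total_cost P S \<le> total_cost P S'"
proof -
  define c where "c i = cum_lot S' i - cum_lot S i" for i
  define w where "w = (\<Sum>j\<in>scens P. scen_prob P j * (1 - viol S j))"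
  let ?first = "{1..stage P}" and ?second = "{stage P + 1..horizon P}"
  have stage: "1 \<le> stage P" "stage P \<le> horizon P" using P by (auto simp: slscc_data_def)
  have c0: "c 0 = 0" by (simp add: c_def cum_lot_def)
  have c_nonneg: "0 \<le> c i" if "i \<le> horizon P" for i using less[OF that] by (simp add: c_def)
  have lot_diff: "lot S' i - lot S i = c i - c (i - 1)" if "1 \<le> i" for i
    using cum_lot_diff[of "i - 1" i S] cum_lot_diff[of "i - 1" i S'] that by (simp add: c_def)
  have stock_diff: "stock S' i - stock S i = c i" if "i \<le> stage P" for i
    using stock_eq[OF S that] stock_eq[OF S' that] by (simp add: c_def)
  \<comment> \<open>The probabilities sum to 1, so this is the chance constraint of \<open>S\<close>.\<close>
  have w_ge: "1 - risk P \<le> w"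
  proof -
    have "w = (\<Sum>j\<in>scens P. scen_prob P j) - (\<Sum>j\<in>scens P. scen_prob P j * viol S j)"
      by (simp add: w_def algebra_simps sum_subtractf)
    then show ?thesis using P S by (simp add: slscc_data_def feasible_def)
  qed
  have h_nonneg: "0 \<le> hold_cost P i" if "i \<in> ?second" for i
    using P that by (simp add: slscc_data_def)
  have scen_diff: "(1 - viol S j) * c i \<le> scen_stock S' j i - scen_stock S j i"
    if "i \<in> ?second" "j \<in> scens P" for i j
    using feasible_scen_stock_ge[OF S' that] tight[OF that] viols[OF that(2)]
    by (simp add: c_def algebra_simps)
  have second_holding: "(\<Sum>i\<in>?second. w * hold_cost P i * c i)
      \<le> (\<Sum>j\<in>scens P. scen_prob P j * (\<Sum>i\<in>?second. hold_cost P i * scen_stock S' j i))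
      - (\<Sum>j\<in>scens P. scen_prob P j * (\<Sum>i\<in>?second. hold_cost P i * scen_stock S j i))"
  proof -
    have "(\<Sum>i\<in>?second. w * hold_cost P i * c i)
        = (\<Sum>i\<in>?second. \<Sum>j\<in>scens P. scen_prob P j * (hold_cost P i * ((1 - viol S j) * c i)))"
      unfolding w_def sum_distrib_right by (intro sum.cong refl) (simp add: mult_ac)
    also have "\<dots> = (\<Sum>j\<in>scens P. \<Sum>i\<in>?second. scen_prob P j * (hold_cost P i * ((1 - viol S j) * c i)))"
      by (rule sum.swap)
    also have "\<dots> \<le> (\<Sum>j\<in>scens P. \<Sum>i\<in>?second.
        scen_prob P j * (hold_cost P i * (scen_stock S' j i - scen_stock S j i)))"
      by (intro sum_mono mult_left_mono scen_diff h_nonneg)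
        (use P in \<open>auto simp: slscc_data_def\<close>)
    also have "\<dots> = (\<Sum>j\<in>scens P. scen_prob P j * (\<Sum>i\<in>?second. hold_cost P i * scen_stock S' j i))
      - (\<Sum>j\<in>scens P. scen_prob P j * (\<Sum>i\<in>?second. hold_cost P i * scen_stock S j i))"
      by (simp add: sum_distrib_left sum_subtractf right_diff_distrib)
    finally show ?thesis .
  qed
  have first_cost: "(\<Sum>i\<in>?first. prod_cost P i * lot S' i + setup_cost P i * setup_var S' i
        + hold_cost P i * stock S' i)
      - (\<Sum>i\<in>?first. prod_cost P i * lot S i + setup_cost P i * setup_var S i
        + hold_cost P i * stock S i)
      = (\<Sum>i\<in>?first. prod_cost P i * (c i - c (i - 1))) + (\<Sum>i\<in>?first. hold_cost P i * c i)"
    unfolding sum_subtractf[symmetric] sum.distrib[symmetric]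
  proof (rule sum.cong[OF refl])
    fix i assume i: "i \<in> ?first"
    then have "setup_var S i = setup_var S' i" using setups stage by auto
    moreover have "c i - c (i - 1) = lot S' i - lot S i" "c i = stock S' i - stock S i"
      using i lot_diff[of i] stock_diff[of i] by auto
    ultimately show "prod_cost P i * lot S' i + setup_cost P i * setup_var S' i
        + hold_cost P i * stock S' i
        - (prod_cost P i * lot S i + setup_cost P i * setup_var S i + hold_cost P i * stock S i)
        = prod_cost P i * (c i - c (i - 1)) + hold_cost P i * c i"
      by (simp add: right_diff_distrib)
  qed
  have second_prod: "(\<Sum>i\<in>?second. prod_cost P i * lot S' i + setup_cost P i * setup_var S' i)
      - (\<Sum>i\<in>?second. prod_cost P i * lot S i + setup_cost P i * setup_var S i)
      = (\<Sum>i\<in>?second. prod_cost P i * (c i - c (i - 1)))"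
    unfolding sum_subtractf[symmetric]
  proof (rule sum.cong[OF refl])
    fix i assume i: "i \<in> ?second"
    then have "setup_var S i = setup_var S' i" using setups by auto
    moreover have "c i - c (i - 1) = lot S' i - lot S i" using i lot_diff[of i] by auto
    ultimately show "prod_cost P i * lot S' i + setup_cost P i * setup_var S' i
        - (prod_cost P i * lot S i + setup_cost P i * setup_var S i)
        = prod_cost P i * (c i - c (i - 1))"
      by (simp add: right_diff_distrib)
  qed
  have split: "(\<Sum>i=1..horizon P. f i) = sum f ?first + sum f ?second" for f :: "nat \<Rightarrow> real"
    using sum_split_at[of 1 "stage P" "horizon P" f] stage by simp
  \<comment> \<open>The boundary term of the summation by parts vanishes since \<open>\<alpha>\<^bsub>T+1\<^esub> = 0\<close>.\<close>
  have by_parts: "(\<Sum>i=1..horizon P. prod_cost P i * (c i - c (i - 1)))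
      = (\<Sum>i=1..horizon P. (prod_cost P i - prod_cost P (i + 1)) * c i)"
    using sum_by_parts[of c "prod_cost P" "horizon P", OF c0] P by (simp add: slscc_data_def)
  have "0 \<le> (\<Sum>i\<in>?first. (prod_cost P i - prod_cost P (i + 1) + hold_cost P i) * c i)"
  proof (intro sum_nonneg mult_nonneg_nonneg c_nonneg)
    fix i assume "i \<in> ?first"
    then show "0 \<le> prod_cost P i - prod_cost P (i + 1) + hold_cost P i" "i \<le> horizon P"
      using WW stage by (simp_all add: strong_wagner_whitin_def algebra_simps)
  qed
  moreover have "0 \<le> (\<Sum>i\<in>?second. (prod_cost P i - prod_cost P (i + 1) + w * hold_cost P i) * c i)"
  proof (intro sum_nonneg mult_nonneg_nonneg c_nonneg)
    fix i assume i: "i \<in> ?second"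
    show "i \<le> horizon P" using i by simp
    have "(1 - risk P) * hold_cost P i \<le> w * hold_cost P i"
      using w_ge h_nonneg[OF i] by (rule mult_right_mono)
    moreover have "prod_cost P (i + 1) \<le> prod_cost P i + (1 - risk P) * hold_cost P i"
    proof (cases "i = horizon P")
      case True
      then show ?thesis using last i P by (auto simp: slscc_data_def)
    next
      case False
      then have "i \<in> {stage P + 1..horizon P - 1}" using i by auto
      then show ?thesis using WW by (auto simp: strong_wagner_whitin_def)
    qed
    ultimately show "0 \<le> prod_cost P i - prod_cost P (i + 1) + w * hold_cost P i" by linarith
  qed
  ultimately have "0 \<le> (\<Sum>i=1..horizon P. (prod_cost P i - prod_cost P (i + 1)) * c i)
      + (\<Sum>i\<in>?first. hold_cost P i * c i) + (\<Sum>i\<in>?second. w * hold_cost P i * c i)"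
    unfolding split by (simp add: sum.distrib distrib_right)
  then have "0 \<le> (\<Sum>i\<in>?first. prod_cost P i * (c i - c (i - 1)))
      + (\<Sum>i\<in>?second. prod_cost P i * (c i - c (i - 1)))
      + (\<Sum>i\<in>?first. hold_cost P i * c i) + (\<Sum>i\<in>?second. w * hold_cost P i * c i)"
    unfolding by_parts[symmetric] split .
  then show ?thesis
    using first_cost second_prod second_holding unfolding total_cost_def by linarith
qed

text \<open>The binary decisions, cut down to the periods and scenarios of the instance. Plans are total
  functions, so only this restriction ranges over a finite set.\<close>

definition decisions :: "slscc \<Rightarrow> plan \<Rightarrow> nat set \<times> nat set" where
  "decisions P S = ({i \<in> {1..horizon P}. setup_var S i = 1}, kept P S)"

text \<open>The least cumulative production depends on a plan only through its decisions. So it also bounds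
  the cumulative production of \<open>S'\<close> from below.\<close>

lemma lean_best_for_decisions:
  assumes P: "slscc_data P" and WW: "strong_wagner_whitin P"
    and last: "stage P < horizon P \<Longrightarrow>
           0 \<le> prod_cost P (horizon P) + (1 - risk P) * hold_cost P (horizon P)"
    and S: "feasible P S" and S': "feasible P S'"
    and same: "decisions P S = decisions P S'"
  shows "total_cost P (lean P S) \<le> total_cost P S'"
proof -
  have set_iff: "setup_var S i = 1 \<longleftrightarrow> setup_var S' i = 1" if "i \<in> {1..horizon P}" for i
    using same that by (auto simp: decisions_def)
  have y: "setup_var S (horizon P + 1) = 1" "setup_var S' (horizon P + 1) = 1"
    using S S' by (auto simp: feasible_def)
  have kept: "kept P S = kept P S'" using same by (simp add: decisions_def)
  have setups: "setup_var S i = setup_var S' i" if "i \<in> {1..horizon P}" for i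
  proof -
    have "setup_var S i \<in> {0, 1}" "setup_var S' i \<in> {0, 1}"
      using S S' that by (auto simp: feasible_def)
    then show ?thesis using set_iff[OF that] by auto
  qed
  have viols: "viol S j = viol S' j" if "j \<in> scens P" for j
  proof -
    have "viol S j \<in> {0, 1}" "viol S' j \<in> {0, 1}" using S S' that by (auto simp: feasible_def)
    moreover have "viol S j = 0 \<longleftrightarrow> viol S' j = 0" using kept that by (auto simp: kept_def)
    ultimately show ?thesis by auto
  qed
  have next_eq: "next_setup S i = next_setup S' i" if i: "i \<le> horizon P" for i
  proof (rule next_setup_eqI)
    note props = next_setup_props[OF y(2) i]
    have agree: "setup_var S k = 1 \<longleftrightarrow> setup_var S' k = 1" if "1 \<le> k" "k \<le> horizon P + 1" for k
      using y setups[of k] that by (cases "k = horizon P + 1") auto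
    show "i + 1 \<le> next_setup S' i" by (fact props(1))
    show "setup_var S (next_setup S' i) = 1" using agree props(1-3) by auto
    show "setup_var S l \<noteq> 1" if "i + 1 \<le> l" "l < next_setup S' i" for l
      using agree[of l] props(2) props(4)[OF that] that by auto
  qed
  have "required P S k = required P S' k" for k
    using kept by (simp add: required_def max_dem_def)
  then have lean_cum: "lean_cum P S i = lean_cum P S' i" if "i \<le> horizon P" for i
    using next_eq[OF that] by (simp add: lean_cum_def)
  show ?thesis
  proof (rule less_production_is_cheaper[OF P WW last lean_feasible[OF P S] S'])
    fix i j assume "i \<in> {stage P + 1..horizon P}" "j \<in> scens P"
    then have "viol S j \<in> {0, 1}" using S by (auto simp: feasible_def)
    then show "scen_stock (lean P S) j i
      = (cum_lot (lean P S) i - cum_dem P (stage P) - cum_scen_dem P j i) * (1 - viol (lean P S) j)"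
      unfolding cum_lot_lean[OF P S] by (auto simp: lean_def plan_of_cum_def)
  next
    fix i assume i: "i \<le> horizon P"
    show "cum_lot (lean P S) i \<le> cum_lot S' i"
      using lean_cum_le[OF P S' i] lean_cum[OF i] by (simp add: cum_lot_lean[OF P S])
  qed (use setups viols in auto)
qed

section \<open>Existence of an optimal lean plan\<close>

lemma optimal_lean_exists:
  assumes P: "slscc_data P" and WW: "strong_wagner_whitin P"
    and last: "stage P < horizon P \<Longrightarrow>
           0 \<le> prod_cost P (horizon P) + (1 - risk P) * hold_cost P (horizon P)"
  shows "\<exists>S. feasible P S \<and> optimal P (lean P S)"
proof -
  define K where "K = decisions P ` {S. feasible P S}"
  define rep where "rep k = (SOME S. feasible P S \<and> decisions P S = k)" for k
  have rep: "feasible P (rep k) \<and> decisions P (rep k) = k" if "k \<in> K" for k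
    unfolding rep_def by (rule someI_ex) (use that in \<open>auto simp: K_def\<close>)
  have "K \<subseteq> Pow {1..horizon P} \<times> Pow (scens P)"
    by (auto simp: K_def decisions_def kept_def)
  then have fin: "finite K" by (rule finite_subset) auto
  have ne: "K \<noteq> {}" using feasible_exists[OF P] by (auto simp: K_def)
  define best where "best = arg_min_on (\<lambda>k. total_cost P (lean P (rep k))) K"
  have best: "best \<in> K" "\<And>k. k \<in> K \<Longrightarrow> total_cost P (lean P (rep best)) \<le> total_cost P (lean P (rep k))"
    unfolding best_def by (rule arg_min_if_finite(1)[OF fin ne], rule arg_min_least[OF fin ne])
  have "total_cost P (lean P (rep best)) \<le> total_cost P S'" if S': "feasible P S'" for S'
  proof -
    have k: "decisions P S' \<in> K" using S' by (simp add: K_def)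
    have "total_cost P (lean P (rep best)) \<le> total_cost P (lean P (rep (decisions P S')))"
      by (rule best(2)[OF k])
    also have "\<dots> \<le> total_cost P S'"
      using lean_best_for_decisions[OF P WW last conjunct1[OF rep[OF k]] S' conjunct2[OF rep[OF k]]] .
    finally show ?thesis .
  qed
  then show ?thesis using rep[OF best(1)] lean_feasible[OF P] unfolding optimal_def by blast
qed

theorem proposition2:
  fixes P :: slscc
  assumes "slscc_data P"
    and "strong_wagner_whitin P"
    and "stage P < horizon P \<Longrightarrow>
           0 \<le> prod_cost P (horizon P) + (1 - risk P) * hold_cost P (horizon P)"
  shows "\<exists>S. optimal P S \<and>
    (\<forall>i\<in>{1..horizon P}. lot S i > 0 \<longrightarrow>
       lot S i =
         (if next_setup S i \<le> stage P then \<Sum>t=i..next_setup S i - 1. dem P t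
          else if i \<le> stage P
          then (\<Sum>t=i..stage P. dem P t) + max_dem P S (next_setup S i - 1)
          else max_dem P S (next_setup S i - 1) - max_dem P S (i - 1))) \<and>
    (\<forall>i\<in>{1..stage P}.
       stock S i =
         (if next_setup S i \<le> stage P then \<Sum>t=i+1..next_setup S i - 1. dem P t
          else (\<Sum>t=i+1..stage P. dem P t) + max_dem P S (next_setup S i - 1))) \<and>
    (\<forall>j\<in>scens P. viol S j = 0 \<longrightarrow>
       (\<forall>i\<in>{stage P + 1..horizon P}.
          scen_stock S j i =
            max_dem P S (next_setup S i - 1) - (\<Sum>t=stage P + 1..i. scen_dem P j t))) \<and>
    (\<forall>j\<in>scens P. viol S j = 1 \<longrightarrow>
       (\<forall>i\<in>{stage P + 1..horizon P}. scen_stock S j i = 0))"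
proof -
  obtain S0 where S0: "feasible P S0" and opt: "optimal P (lean P S0)"
    using optimal_lean_exists[OF assms] by blast
  let ?S = "lean P S0"
  have y: "setup_var S0 (horizon P + 1) = 1" using S0 by (simp add: feasible_def)
  have stage: "stage P \<le> horizon P" using assms(1) by (simp add: slscc_data_def)
  \<comment> \<open>The case distinction shared by the lots (\<open>l = i - 1\<close>) and the stocks (\<open>l = i\<close>) of the first stage.\<close>
  have first_stage: "required P S0 (next_setup S0 i - 1) - cum_dem P l =
      (if next_setup S0 i \<le> stage P then \<Sum>t=l+1..next_setup S0 i - 1. dem P t
       else (\<Sum>t=l+1..stage P. dem P t) + max_dem P S0 (next_setup S0 i - 1))"
    if "l \<le> i" "i \<le> stage P" for i l
  proof -
    have l: "l \<le> next_setup S0 i - 1" using next_setup_props(1)[OF y, of i] that stage by simp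
    show ?thesis
    proof (cases "next_setup S0 i \<le> stage P")
      case True
      then have "next_setup S0 i - 1 \<le> stage P" by simp
      with True show ?thesis using cum_dem_diff[OF l, of P] by (simp add: required_def)
    next
      case False
      then have "stage P \<le> next_setup S0 i - 1" by simp
      then show ?thesis
        using False cum_dem_diff[of l "stage P" P] that by (simp add: required_after_stage)
    qed
  qed
  have a: "lot ?S i =
      (if next_setup ?S i \<le> stage P then \<Sum>t=i..next_setup ?S i - 1. dem P t
       else if i \<le> stage P
       then (\<Sum>t=i..stage P. dem P t) + max_dem P ?S (next_setup ?S i - 1)
       else max_dem P ?S (next_setup ?S i - 1) - max_dem P ?S (i - 1))"
    if i: "i \<in> {1..horizon P}" and pos: "lot ?S i > 0" for i
  proof -
    have i': "1 \<le> i" "i \<le> horizon P" using i by auto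
    have after: "i < next_setup S0 i" using next_setup_props(1)[OF y i'(2)] by simp
    have lot_eq: "lot ?S i = required P S0 (next_setup S0 i - 1) - required P S0 (i - 1)"
      using lean_cum_step[OF S0 i'] pos by (auto simp: lean_def plan_of_cum_def split: if_splits)
    show ?thesis
    proof (cases "i \<le> stage P")
      case True
      then have "i - 1 \<le> stage P" by simp
      then have "required P S0 (i - 1) = cum_dem P (i - 1)" by (simp add: required_def)
      then show ?thesis using first_stage[of "i - 1" i] i' True lot_eq by simp
    next
      case False
      then have "stage P \<le> i - 1" "stage P \<le> next_setup S0 i - 1" "\<not> next_setup S0 i \<le> stage P"
        using after by auto
      then show ?thesis using False lot_eq by (simp add: required_after_stage)
    qed
  qed
  have b: "stock ?S i =
      (if next_setup ?S i \<le> stage P then \<Sum>t=i+1..next_setup ?S i - 1. dem P t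
       else (\<Sum>t=i+1..stage P. dem P t) + max_dem P ?S (next_setup ?S i - 1))"
    if "i \<in> {1..stage P}" for i
  proof -
    have "stock ?S i = required P S0 (next_setup S0 i - 1) - cum_dem P i"
      by (simp add: lean_def plan_of_cum_def lean_cum_def)
    then show ?thesis using first_stage[of i i] that by simp
  qed
  have c: "scen_stock ?S j i =
      max_dem P ?S (next_setup ?S i - 1) - (\<Sum>t=stage P + 1..i. scen_dem P j t)"
    if "viol ?S j = 0" "i \<in> {stage P + 1..horizon P}" for i j
  proof -
    have "scen_stock ?S j i
        = required P S0 (next_setup S0 i - 1) - cum_dem P (stage P) - cum_scen_dem P j i"
      using that(1) by (simp add: lean_def plan_of_cum_def lean_cum_def)
    moreover have "stage P \<le> next_setup S0 i - 1"
      using next_setup_props(1)[OF y, of i] that(2) by auto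
    ultimately show ?thesis by (simp add: required_after_stage cum_scen_dem_def)
  qed
  have d: "scen_stock ?S j i = 0" if "viol ?S j = 1" for i j
    using that by (simp add: lean_def plan_of_cum_def)
  show ?thesis
    by (rule exI[of _ ?S]) (intro conjI ballI impI opt a b c d)
qed

end
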